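(* Let $(A,\mu,\Delta=[-,r]_*,\alpha,r)$ be a coboundary $\epsilon$-Hom-bialgebra with $r$ anti-symmetric. Then $$A_{HLie}=(A,[-,-]=\mu\circ(Id-\tau),\delta=(Id-\tau)\circ\Delta,\alpha,r)$$ is a coboundary Hom-Lie bialgebra.
   Context: Throughout, $\mathbf{k}$ is a fixed field of characteristic $0$; vector spaces, linear maps and tensor products are over $\mathbf{k}$. $\tau$ denotes the twist $\tau(x\otimes y)=y\otimes x$. A $2$-tensor $r$ is anti-symmetric if $\tau(r)=-r$, and $\alpha$-invariant if $\alpha^{\otimes 2}(r)=r$. An $\epsilon$-Hom-bialgebra $(A,\mu,\Delta,\alpha)$ is a $\mathbf{k}$-vector space $A$ with linear maps $\mu\colon A^{\otimes 2}\to A$, $\Delta\colon A\to A^{\otimes 2}$, $\alpha\colon A\to A$ such that: $\alpha\circ\mu=\mu\circ\alpha^{\otimes 2}$; $\mu\circ(\alpha\otimes\mu)=\mu\circ(\mu\otimes\alpha)$; $\alpha^{\otimes 2}\circ\Delta=\Delta\circ\alpha$; $(\alpha\otimes\Delta)\circ\Delta=(\Delta\otimes\alpha)\circ\Delta$; and $\Delta\circ\mu=(\mu\otimes\alpha)\circ(\alpha\otimes\Delta)+(\alpha\otimes\mu)\circ(\Delta\otimes\alpha)$. For $a\in A$ and $r=\sum u_i\otimes v_i\in A^{\otimes 2}$, set $[a,r]_*=\sum\mu(a,u_i)\otimes\alpha(v_i)-\alpha(u_i)\otimes\mu(v_i,a)$. A coboundary $\epsilon$-Hom-bialgebra $(A,\mu,\Delta,\alpha,r)$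 is an $\epsilon$-Hom-bialgebra $(A,\mu,\Delta,\alpha)$ together with an $\alpha$-invariant $r\in A^{\otimes 2}$ such that $\Delta=[-,r]_*$. Let $\sigma$ denote the cyclic permutation $(1\,2\,3)$ acting on $3$-fold tensors. A Hom-Lie algebra $(L,[-,-],\alpha)$ is a vector space $L$ with a linear map $\alpha\colon L\to L$ and an anti-symmetric bilinear bracket such that $\alpha\circ[-,-]=[-,-]\circ\alpha^{\otimes 2}$ and $[-,-]\circ([-,-]\otimes\alpha)\circ(Id+\sigma+\sigma^2)=0$, i.e. $[[x,y],\alpha(z)]+[[z,x],\alpha(y)]+[[y,z],\alpha(x)]=0$. A Hom-Lie coalgebra $(L,\delta,\alpha)$ is a vector space $L$ with linear maps $\alpha\colon L\to L$ and $\delta\colon L\to L^{\otimes 2}$ such that $\delta\circ\alpha=\alpha^{\otimes 2}\circ\delta$, $\tau\circ\delta=-\delta$, and $(Id+\sigma+\sigma^2)\circ(\alpha\otimes\delta)\circ\delta=0$. For $x\in L$, set $\mathrm{ad}_x(y_1\otimes y_2)=[x,y_1]\otimes\alpha(y_2)+\alpha(y_1)\otimes[x,y_2]$ on $L^{\otimes 2}$ (extended linearly); for $\gamma\in L^{\otimes 2}$, $\mathrm{ad}(\gamma)\colon L\to L^{\otimes 2}$ is the map $\mathrm{ad}(\gamma)(x)=\mathrm{ad}_x(\gamma)$. A Hom-Lie bialgebra $(L,[-,-],\delta,\alpha)$ is a quadruple such that $(L,[-,-],\alpha)$ is a Hom-Lie algebra, $(L,\delta,\alpha)$ is a Hom-Lie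 coalgebra, and $\delta([x,y])=\mathrm{ad}_{\alpha(x)}(\delta(y))-\mathrm{ad}_{\alpha(y)}(\delta(x))$ for all $x,y\in L$. A coboundary Hom-Lie bialgebra $(L,[-,-],\delta,\alpha,r)$ is a Hom-Lie bialgebra $(L,[-,-],\delta,\alpha)$ together with an $\alpha$-invariant $r\in L^{\otimes 2}$ such that $\delta=\mathrm{ad}(r)$. *)

theory Defs
  imports "HOL.Vector_Spaces" "HOL-Library.Function_Algebras"
begin

text \<open>
  Vector spaces over an arbitrary field are given by the library locale
  \<open>vector_space scale\<close>, whose carrier is a whole type.  The tensor powers
  \<open>A\<^sup>\<otimes>\<^sup>2\<close> and \<open>A\<^sup>\<otimes>\<^sup>3\<close> are modelled concretely: \<open>x \<otimes> y\<close> is the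
  evaluation functional \<open>\<beta> \<mapsto> \<beta>(x, y)\<close> on the bilinear forms on \<open>A\<close>, and \<open>A\<^sup>\<otimes>\<^sup>2\<close> is the
  span of these functionals; similarly for \<open>A\<^sup>\<otimes>\<^sup>3\<close> with trilinear forms.  Over a field this
  is the algebraic tensor product; the universal properties are proved below
  (\<open>lift2\<close> and \<open>lift3\<close> theorems), and every map on tensors is specified only by its
  values on pure tensors.  Functionals are functions on all \<open>\<beta>\<close>, with value \<open>0\<close> when
  \<open>\<beta>\<close> is not multilinear; the vector space operations on them are pointwise.
\<close>

type_synonym ('a, 'k) tensor2 = "('a \<Rightarrow> 'a \<Rightarrow> 'k) \<Rightarrow> 'k"
type_synonym ('a, 'k) tensor3 = "('a \<Rightarrow> 'a \<Rightarrow> 'a \<Rightarrow> 'k) \<Rightarrow> 'k"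

definition fun_scale :: "'k::times \<Rightarrow> ('b \<Rightarrow> 'k) \<Rightarrow> 'b \<Rightarrow> 'k"
  where "fun_scale c t = (\<lambda>\<beta>. c * t \<beta>)"

lemma vector_space_fun_scale: "vector_space (fun_scale :: 'k::field \<Rightarrow> ('b \<Rightarrow> 'k) \<Rightarrow> 'b \<Rightarrow> 'k)"
  by unfold_locales (auto simp: fun_scale_def fun_eq_iff algebra_simps)

lemma vector_space_times: "vector_space ((*) :: 'k::field \<Rightarrow> 'k \<Rightarrow> 'k)"
  by unfold_locales (auto simp: algebra_simps)

definition linear_on ::
  "'v set \<Rightarrow> ('k \<Rightarrow> 'v \<Rightarrow> 'v) \<Rightarrow> ('k \<Rightarrow> 'w \<Rightarrow> 'w) \<Rightarrow> ('v::plus \<Rightarrow> 'w::plus) \<Rightarrow> bool"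
  where "linear_on S sV sW f \<longleftrightarrow>
    (\<forall>x\<in>S. \<forall>y\<in>S. f (x + y) = f x + f y) \<and> (\<forall>c. \<forall>x\<in>S. f (sV c x) = sW c (f x))"

context vector_space
begin

definition bilinear_map :: "('a \<Rightarrow> 'v \<Rightarrow> 'v) \<Rightarrow> ('b \<Rightarrow> 'b \<Rightarrow> 'v::ab_group_add) \<Rightarrow> bool"
  where "bilinear_map sV f \<longleftrightarrow>
    (\<forall>y. Vector_Spaces.linear scale sV (\<lambda>x. f x y)) \<and>
    (\<forall>x. Vector_Spaces.linear scale sV (\<lambda>y. f x y))"

definition trilinear_map :: "('a \<Rightarrow> 'v \<Rightarrow> 'v) \<Rightarrow> ('b \<Rightarrow> 'b \<Rightarrow> 'b \<Rightarrow> 'v::ab_group_add) \<Rightarrow> bool"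
  where "trilinear_map sV f \<longleftrightarrow>
    (\<forall>y z. Vector_Spaces.linear scale sV (\<lambda>x. f x y z)) \<and>
    (\<forall>x z. Vector_Spaces.linear scale sV (\<lambda>y. f x y z)) \<and>
    (\<forall>x y. Vector_Spaces.linear scale sV (\<lambda>z. f x y z))"

definition tensor2 :: "'b \<Rightarrow> 'b \<Rightarrow> ('b, 'a) tensor2"  (infixr \<open>\<otimes>\<close> 75)
  where "x \<otimes> y = (\<lambda>\<beta>. if bilinear_map (*) \<beta> then \<beta> x y else 0)"

definition tensor3 :: "'b \<Rightarrow> 'b \<Rightarrow> 'b \<Rightarrow> ('b, 'a) tensor3"
  where "tensor3 x y z = (\<lambda>\<beta>. if trilinear_map (*) \<beta> then \<beta> x y z else 0)"

definition tensor_space2 :: "('b, 'a) tensor2 set"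
  where "tensor_space2 = module.span fun_scale {x \<otimes> y | x y. True}"

definition tensor_space3 :: "('b, 'a) tensor3 set"
  where "tensor_space3 = module.span fun_scale {tensor3 x y z | x y z. True}"

text \<open>
  The linear map on tensors with prescribed values on pure tensors.  Its values on
  functionals outside the tensor space are arbitrary and never matter.
\<close>

definition lift2 :: "('a \<Rightarrow> 'v \<Rightarrow> 'v) \<Rightarrow> ('b \<Rightarrow> 'b \<Rightarrow> 'v::ab_group_add) \<Rightarrow> ('b, 'a) tensor2 \<Rightarrow> 'v"
  where "lift2 sV f =
    (SOME g. Vector_Spaces.linear fun_scale sV g \<and> (\<forall>x y. g (x \<otimes> y) = f x y))"

definition lift3 ::
  "('a \<Rightarrow> 'v \<Rightarrow> 'v) \<Rightarrow> ('b \<Rightarrow> 'b \<Rightarrow> 'b \<Rightarrow> 'v::ab_group_add) \<Rightarrow> ('b, 'a) tensor3 \<Rightarrow> 'v"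
  where "lift3 sV f =
    (SOME g. Vector_Spaces.linear fun_scale sV g \<and> (\<forall>x y z. g (tensor3 x y z) = f x y z))"

end

lemma separating_functional:
  fixes sV :: "'k::field \<Rightarrow> 'v::ab_group_add \<Rightarrow> 'v"
  assumes V: "vector_space sV" and "v \<noteq> 0"
  obtains \<phi> where "Vector_Spaces.linear sV (*) \<phi>" "\<phi> v = (1::'k)"
proof -
  interpret V: vector_space sV by fact
  interpret k: vector_space "(*) :: 'k \<Rightarrow> 'k \<Rightarrow> 'k" by (rule vector_space_times)
  interpret P: vector_space_pair sV "(*) :: 'k \<Rightarrow> 'k \<Rightarrow> 'k" ..
  have "V.independent {v}"
    using \<open>v \<noteq> 0\<close> by (simp add: V.independent_insert V.independent_empty)
  from P.linear_independent_extend[OF this, of "\<lambda>_. 1"] that show thesis by auto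
qed

lemma linear_extension_of_evaluations:
  fixes sV :: "'k::field \<Rightarrow> 'v::ab_group_add \<Rightarrow> 'v" and E :: "'i \<Rightarrow> 'f \<Rightarrow> 'k" and f :: "'i \<Rightarrow> 'v"
  assumes V: "vector_space sV"
    and E: "\<And>\<phi>. Vector_Spaces.linear sV (*) \<phi> \<Longrightarrow> \<exists>w. \<forall>i. E i w = \<phi> (f i)"
  shows "\<exists>g. Vector_Spaces.linear fun_scale sV g \<and> (\<forall>i. g (E i) = f i)"
proof -
  interpret V: vector_space sV by fact
  interpret F: vector_space "fun_scale :: 'k \<Rightarrow> ('f \<Rightarrow> 'k) \<Rightarrow> 'f \<Rightarrow> 'k"
    by (rule vector_space_fun_scale)
  interpret P: vector_space_pair "fun_scale :: 'k \<Rightarrow> ('f \<Rightarrow> 'k) \<Rightarrow> 'f \<Rightarrow> 'k" sV ..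
  obtain B where B: "B \<subseteq> range E" "F.independent B" "range E \<subseteq> F.span B"
    using F.maximal_independent_subset[of "range E"] by metis
  obtain g where g: "Vector_Spaces.linear fun_scale sV g"
    and gB: "\<And>b. b \<in> B \<Longrightarrow> g b = f (SOME i. E i = b)"
    using P.linear_independent_extend[OF B(2), of "\<lambda>b. f (SOME i. E i = b)"] by auto
  interpret g: Vector_Spaces.linear fun_scale sV g by fact
  have "g (E i) = f i" for i
  proof (rule ccontr)
    assume "g (E i) \<noteq> f i"
    then obtain \<phi> where \<phi>: "Vector_Spaces.linear sV (*) \<phi>" and \<phi>1: "\<phi> (g (E i) - f i) = (1::'k)"
      using separating_functional[OF V, of "g (E i) - f i"] by auto
    interpret phi: Vector_Spaces.linear sV "(*)" \<phi> by fact
    obtain w where w: "\<And>j. E j w = \<phi> (f j)" using E[OF \<phi>] by auto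
    have span: "\<phi> (g t) = t w" if "t \<in> F.span B" for t
      using that
    proof (induction rule: F.span_induct_alt)
      case base
      have "g 0 = 0" "\<phi> 0 = 0" by (rule g.zero, rule phi.zero)
      then show ?case by (simp only: zero_fun_def)
    next
      case (step c b t)
      then have "E (SOME i. E i = b) = b" using B(1) by (auto intro: someI)
      then have "\<phi> (g b) = b w" using w gB[OF step(1)] by metis
      moreover have "\<phi> (g (fun_scale c b + t)) = c * \<phi> (g b) + \<phi> (g t)"
        by (simp only: g.add g.scale phi.add phi.scale)
      moreover have "(fun_scale c b + t) w = c * b w + t w"
        by (simp add: fun_scale_def)
      ultimately show ?case using step by (simp only:)
    qed
    have "E i \<in> F.span B" using B(3) by blast
    from span[OF this] have "\<phi> (g (E i)) = \<phi> (f i)" by (simp only: w)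
    then show False using \<phi>1 by (simp add: phi.diff)
  qed
  then show ?thesis using g by blast
qed

context vector_space
begin

lemma
  assumes V: "vector_space sV" and f: "bilinear_map sV f"
  shows linear_lift2: "Vector_Spaces.linear fun_scale sV (lift2 sV f)"
    and lift2_tensor2: "lift2 sV f (x \<otimes> y) = f x y"
proof -
  have "\<exists>w. \<forall>i. (\<lambda>(x, y). x \<otimes> y) i w = \<phi> ((\<lambda>(x, y). f x y) i)"
    if "Vector_Spaces.linear sV (*) \<phi>" for \<phi>
  proof -
    have "bilinear_map (*) (\<lambda>x y. \<phi> (f x y))"
      using f Vector_Spaces.linear_compose[OF _ that] unfolding bilinear_map_def o_def by blast
    then show ?thesis by (intro exI[of _ "\<lambda>x y. \<phi> (f x y)"]) (auto simp: tensor2_def)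
  qed
  from linear_extension_of_evaluations[OF V, of "\<lambda>(x, y). x \<otimes> y" "\<lambda>(x, y). f x y", OF this]
  have "\<exists>g. Vector_Spaces.linear fun_scale sV g \<and> (\<forall>x y. g (x \<otimes> y) = f x y)" by auto
  from someI_ex[OF this]
  show "Vector_Spaces.linear fun_scale sV (lift2 sV f)" "lift2 sV f (x \<otimes> y) = f x y"
    by (auto simp: lift2_def)
qed

lemma
  assumes V: "vector_space sV" and f: "trilinear_map sV f"
  shows linear_lift3: "Vector_Spaces.linear fun_scale sV (lift3 sV f)"
    and lift3_tensor3: "lift3 sV f (tensor3 x y z) = f x y z"
proof -
  have "\<exists>w. \<forall>i. (\<lambda>(x, y, z). tensor3 x y z) i w = \<phi> ((\<lambda>(x, y, z). f x y z) i)"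
    if "Vector_Spaces.linear sV (*) \<phi>" for \<phi>
  proof -
    have "trilinear_map (*) (\<lambda>x y z. \<phi> (f x y z))"
      using f Vector_Spaces.linear_compose[OF _ that] unfolding trilinear_map_def o_def by blast
    then show ?thesis by (intro exI[of _ "\<lambda>x y z. \<phi> (f x y z)"]) (auto simp: tensor3_def)
  qed
  from linear_extension_of_evaluations[OF V, of "\<lambda>(x, y, z). tensor3 x y z" "\<lambda>(x, y, z). f x y z", OF this]
  have "\<exists>g. Vector_Spaces.linear fun_scale sV g \<and> (\<forall>x y z. g (tensor3 x y z) = f x y z)" by auto
  from someI_ex[OF this]
  show "Vector_Spaces.linear fun_scale sV (lift3 sV f)" "lift3 sV f (tensor3 x y z) = f x y z"
    by (auto simp: lift3_def)
qed

lemma linear_on_span_unique: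
  fixes P :: "('f \<Rightarrow> 'a) set" and g h :: "('f \<Rightarrow> 'a) \<Rightarrow> 'v::ab_group_add"
  assumes V: "vector_space sV"
    and g: "linear_on (module.span fun_scale P) fun_scale sV g"
    and h: "linear_on (module.span fun_scale P) fun_scale sV h"
    and eq: "\<And>p. p \<in> P \<Longrightarrow> g p = h p" and t: "t \<in> module.span fun_scale P"
  shows "g t = h t"
proof -
  interpret V: vector_space sV by fact
  interpret F: vector_space "fun_scale :: 'a \<Rightarrow> ('f \<Rightarrow> 'a) \<Rightarrow> 'f \<Rightarrow> 'a"
    by (rule vector_space_fun_scale)
  have lin: "k 0 = 0" if "linear_on (F.span P) fun_scale sV k" for k
  proof -
    have "k (fun_scale 0 0) = sV 0 (k 0)"
      using that F.span_zero unfolding linear_on_def by blast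
    then show ?thesis by (simp del: F.scale_zero_left add: F.scale_zero_right)
  qed
  have "t \<in> F.span P \<and> g t = h t"
    using t
  proof (induction rule: F.span_induct_alt)
    case base
    show ?case by (simp only: lin[OF g] lin[OF h] F.span_zero simp_thms)
  next
    case (step c p t)
    then have p: "p \<in> F.span P" "fun_scale c p \<in> F.span P"
      by (auto intro: F.span_base F.span_scale)
    show ?case
    proof -
      have t: "t \<in> F.span P" "g t = h t" using step by blast+
      have "k (fun_scale c p + t) = sV c (k p) + k t" if "linear_on (F.span P) fun_scale sV k" for k
        using that p t(1) unfolding linear_on_def by simp
      from this[OF g] this[OF h] show ?thesis
        using t eq[OF step(1)] F.span_add[OF p(2) t(1)] by (simp only: simp_thms)
    qed
  qed
  then show ?thesis ..
qed

lemma lift2_unique: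
  assumes V: "vector_space sV" and f: "bilinear_map sV f"
    and g: "linear_on tensor_space2 fun_scale sV g" and gf: "\<And>x y. g (x \<otimes> y) = f x y"
    and t: "t \<in> tensor_space2"
  shows "g t = lift2 sV f t"
proof -
  interpret l: Vector_Spaces.linear fun_scale sV "lift2 sV f" by (rule linear_lift2[OF V f])
  show ?thesis
    by (rule linear_on_span_unique[OF V g[unfolded tensor_space2_def] _ _ t[unfolded tensor_space2_def]])
       (auto simp: linear_on_def l.add l.scale gf lift2_tensor2[OF V f])
qed

lemma lift3_unique:
  assumes V: "vector_space sV" and f: "trilinear_map sV f"
    and g: "linear_on tensor_space3 fun_scale sV g" and gf: "\<And>x y z. g (tensor3 x y z) = f x y z"
    and t: "t \<in> tensor_space3"
  shows "g t = lift3 sV f t"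
proof -
  interpret l: Vector_Spaces.linear fun_scale sV "lift3 sV f" by (rule linear_lift3[OF V f])
  show ?thesis
    by (rule linear_on_span_unique[OF V g[unfolded tensor_space3_def] _ _ t[unfolded tensor_space3_def]])
       (auto simp: linear_on_def l.add l.scale gf lift3_tensor3[OF V f])
qed

lemma bilinear_tensor2: "bilinear_map fun_scale tensor2"
  unfolding bilinear_map_def linear_iff
proof (intro conjI allI ext)
  fix x x' y c and \<beta> :: "'b \<Rightarrow> 'b \<Rightarrow> 'a"
  have *: "\<beta> (x + x') y = \<beta> x y + \<beta> x' y" "\<beta> y (x + x') = \<beta> y x + \<beta> y x'"
    "\<beta> (scale c x) y = c * \<beta> x y" "\<beta> y (scale c x) = c * \<beta> y x"
    if "bilinear_map (*) \<beta>"
    using that unfolding bilinear_map_def linear_iff by blast+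
  show "((x + x') \<otimes> y) \<beta> = (x \<otimes> y + x' \<otimes> y) \<beta>" "(y \<otimes> (x + x')) \<beta> = (y \<otimes> x + y \<otimes> x') \<beta>"
    "(scale c x \<otimes> y) \<beta> = fun_scale c (x \<otimes> y) \<beta>" "(y \<otimes> scale c x) \<beta> = fun_scale c (y \<otimes> x) \<beta>"
    by (simp_all add: tensor2_def fun_scale_def *)
qed (rule vector_space_axioms vector_space_fun_scale)+

lemma trilinear_tensor3: "trilinear_map fun_scale tensor3"
  unfolding trilinear_map_def linear_iff
proof (intro conjI allI ext)
  fix x x' y z c and \<beta> :: "'b \<Rightarrow> 'b \<Rightarrow> 'b \<Rightarrow> 'a"
  have *: "\<beta> (x + x') y z = \<beta> x y z + \<beta> x' y z" "\<beta> y (x + x') z = \<beta> y x z + \<beta> y x' z"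
    "\<beta> y z (x + x') = \<beta> y z x + \<beta> y z x'" "\<beta> (scale c x) y z = c * \<beta> x y z"
    "\<beta> y (scale c x) z = c * \<beta> y x z" "\<beta> y z (scale c x) = c * \<beta> y z x"
    if "trilinear_map (*) \<beta>"
    using that unfolding trilinear_map_def linear_iff by blast+
  show "tensor3 (x + x') y z \<beta> = (tensor3 x y z + tensor3 x' y z) \<beta>"
    "tensor3 y (x + x') z \<beta> = (tensor3 y x z + tensor3 y x' z) \<beta>"
    "tensor3 y z (x + x') \<beta> = (tensor3 y z x + tensor3 y z x') \<beta>"
    "tensor3 (scale c x) y z \<beta> = fun_scale c (tensor3 x y z) \<beta>"
    "tensor3 y (scale c x) z \<beta> = fun_scale c (tensor3 y x z) \<beta>"
    "tensor3 y z (scale c x) \<beta> = fun_scale c (tensor3 y z x) \<beta>"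
    by (simp_all add: tensor3_def fun_scale_def *)
qed (rule vector_space_axioms vector_space_fun_scale)+

definition twist :: "('b, 'a) tensor2 \<Rightarrow> ('b, 'a) tensor2"
  where "twist = lift2 fun_scale (\<lambda>x y. y \<otimes> x)"

definition cyclic :: "('b, 'a) tensor3 \<Rightarrow> ('b, 'a) tensor3"
  where "cyclic = lift3 fun_scale (\<lambda>x y z. tensor3 z x y)"

definition cyclic_sum :: "('b, 'a) tensor3 \<Rightarrow> ('b, 'a) tensor3"
  where "cyclic_sum t = t + cyclic t + cyclic (cyclic t)"

text \<open>\<open>a \<otimes> t\<close> and \<open>t \<otimes> a\<close> in \<open>A\<^sup>\<otimes>\<^sup>3\<close>, for \<open>a\<close> in \<open>A\<close> and \<open>t\<close> in \<open>A\<^sup>\<otimes>\<^sup>2\<close>.\<close>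

definition tensor12 :: "'b \<Rightarrow> ('b, 'a) tensor2 \<Rightarrow> ('b, 'a) tensor3"
  where "tensor12 a = lift2 fun_scale (\<lambda>y z. tensor3 a y z)"

definition tensor21 :: "('b, 'a) tensor2 \<Rightarrow> 'b \<Rightarrow> ('b, 'a) tensor3"
  where "tensor21 t a = lift2 fun_scale (\<lambda>x y. tensor3 x y a) t"

text \<open>
  Tensor products of linear maps.  Here \<open>f, g: A \<rightarrow> A\<close>, \<open>m: A\<^sup>\<otimes>\<^sup>2 \<rightarrow> A\<close> and
  \<open>d: A \<rightarrow> A\<^sup>\<otimes>\<^sup>2\<close>; the five maps are \<open>f \<otimes> g\<close>, \<open>f \<otimes> m\<close>, \<open>m \<otimes> f\<close>,
  \<open>f \<otimes> d\<close> and \<open>d \<otimes> f\<close>.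
\<close>

definition map_lin_lin :: "('b \<Rightarrow> 'b) \<Rightarrow> ('b \<Rightarrow> 'b) \<Rightarrow> ('b, 'a) tensor2 \<Rightarrow> ('b, 'a) tensor2"
  where "map_lin_lin f g = lift2 fun_scale (\<lambda>x y. f x \<otimes> g y)"

definition map_lin_mult ::
  "('b \<Rightarrow> 'b) \<Rightarrow> (('b, 'a) tensor2 \<Rightarrow> 'b) \<Rightarrow> ('b, 'a) tensor3 \<Rightarrow> ('b, 'a) tensor2"
  where "map_lin_mult f m = lift3 fun_scale (\<lambda>x y z. f x \<otimes> m (y \<otimes> z))"

definition map_mult_lin ::
  "(('b, 'a) tensor2 \<Rightarrow> 'b) \<Rightarrow> ('b \<Rightarrow> 'b) \<Rightarrow> ('b, 'a) tensor3 \<Rightarrow> ('b, 'a) tensor2"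
  where "map_mult_lin m f = lift3 fun_scale (\<lambda>x y z. m (x \<otimes> y) \<otimes> f z)"

definition map_lin_comult ::
  "('b \<Rightarrow> 'b) \<Rightarrow> ('b \<Rightarrow> ('b, 'a) tensor2) \<Rightarrow> ('b, 'a) tensor2 \<Rightarrow> ('b, 'a) tensor3"
  where "map_lin_comult f d = lift2 fun_scale (\<lambda>x y. tensor12 (f x) (d y))"

definition map_comult_lin ::
  "('b \<Rightarrow> ('b, 'a) tensor2) \<Rightarrow> ('b \<Rightarrow> 'b) \<Rightarrow> ('b, 'a) tensor2 \<Rightarrow> ('b, 'a) tensor3"
  where "map_comult_lin d f = lift2 fun_scale (\<lambda>x y. tensor21 (d x) (f y))"

text \<open>\<open>[a, r]\<^sub>*\<close>\<close>

definition star_bracket ::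
  "(('b, 'a) tensor2 \<Rightarrow> 'b) \<Rightarrow> ('b \<Rightarrow> 'b) \<Rightarrow> 'b \<Rightarrow> ('b, 'a) tensor2 \<Rightarrow> ('b, 'a) tensor2"
  where "star_bracket \<mu> \<alpha> a =
    lift2 fun_scale (\<lambda>u v. \<mu> (a \<otimes> u) \<otimes> \<alpha> v - \<alpha> u \<otimes> \<mu> (v \<otimes> a))"

text \<open>\<open>ad\<^sub>x\<close> on \<open>L\<^sup>\<otimes>\<^sup>2\<close>, for the bracket \<open>[x, y] = br (x \<otimes> y)\<close>\<close>

definition adj ::
  "(('b, 'a) tensor2 \<Rightarrow> 'b) \<Rightarrow> ('b \<Rightarrow> 'b) \<Rightarrow> 'b \<Rightarrow> ('b, 'a) tensor2 \<Rightarrow> ('b, 'a) tensor2"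
  where "adj br \<alpha> x =
    lift2 fun_scale (\<lambda>y1 y2. br (x \<otimes> y1) \<otimes> \<alpha> y2 + \<alpha> y1 \<otimes> br (x \<otimes> y2))"

end

text \<open>
  A linear map out of \<open>A\<^sup>\<otimes>\<^sup>2\<close> is a function on all functionals of which only the restriction
  to \<open>tensor_space2\<close> is constrained.
\<close>

locale eps_Hom_bialgebra = vector_space scale
  for scale :: "'k::field_char_0 \<Rightarrow> 'a::ab_group_add \<Rightarrow> 'a" +
  fixes \<mu> :: "('a, 'k) tensor2 \<Rightarrow> 'a"
    and \<Delta> :: "'a \<Rightarrow> ('a, 'k) tensor2"
    and \<alpha> :: "'a \<Rightarrow> 'a"
  assumes linear_mu: "linear_on tensor_space2 fun_scale scale \<mu>"
    and linear_Delta: "Vector_Spaces.linear scale fun_scale \<Delta>"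
    and Delta_in: "\<Delta> a \<in> tensor_space2"
    and linear_alpha: "Vector_Spaces.linear scale scale \<alpha>"
    and alpha_mu: "t \<in> tensor_space2 \<Longrightarrow> \<alpha> (\<mu> t) = \<mu> (map_lin_lin \<alpha> \<alpha> t)"
    and hom_assoc: "u \<in> tensor_space3 \<Longrightarrow>
      \<mu> (map_lin_mult \<alpha> \<mu> u) = \<mu> (map_mult_lin \<mu> \<alpha> u)"
    and alpha_Delta: "map_lin_lin \<alpha> \<alpha> (\<Delta> a) = \<Delta> (\<alpha> a)"
    and hom_coassoc: "map_lin_comult \<alpha> \<Delta> (\<Delta> a) = map_comult_lin \<Delta> \<alpha> (\<Delta> a)"
    and Delta_mu: "t \<in> tensor_space2 \<Longrightarrow>
      \<Delta> (\<mu> t) = map_mult_lin \<mu> \<alpha> (map_lin_comult \<alpha> \<Delta> t)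
              + map_lin_mult \<alpha> \<mu> (map_comult_lin \<Delta> \<alpha> t)"

locale coboundary_eps_Hom_bialgebra = eps_Hom_bialgebra scale \<mu> \<Delta> \<alpha>
  for scale :: "'k::field_char_0 \<Rightarrow> 'a::ab_group_add \<Rightarrow> 'a" and \<mu> \<Delta> \<alpha> +
  fixes r :: "('a, 'k) tensor2"
  assumes r_in: "r \<in> tensor_space2"
    and r_invariant: "map_lin_lin \<alpha> \<alpha> r = r"
    and Delta_eq: "\<Delta> = (\<lambda>a. star_bracket \<mu> \<alpha> a r)"

locale Hom_Lie_algebra = vector_space scale
  for scale :: "'k::field_char_0 \<Rightarrow> 'a::ab_group_add \<Rightarrow> 'a" +
  fixes br :: "('a, 'k) tensor2 \<Rightarrow> 'a" and \<alpha> :: "'a \<Rightarrow> 'a"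
  assumes linear_br: "linear_on tensor_space2 fun_scale scale br"
    and linear_alpha: "Vector_Spaces.linear scale scale \<alpha>"
    and br_antisym: "br (x \<otimes> y) = - br (y \<otimes> x)"
    and alpha_br: "t \<in> tensor_space2 \<Longrightarrow> \<alpha> (br t) = br (map_lin_lin \<alpha> \<alpha> t)"
    and hom_Jacobi: "u \<in> tensor_space3 \<Longrightarrow> br (map_mult_lin br \<alpha> (cyclic_sum u)) = 0"

locale Hom_Lie_coalgebra = vector_space scale
  for scale :: "'k::field_char_0 \<Rightarrow> 'a::ab_group_add \<Rightarrow> 'a" +
  fixes \<delta> :: "'a \<Rightarrow> ('a, 'k) tensor2" and \<alpha> :: "'a \<Rightarrow> 'a"
  assumes linear_delta: "Vector_Spaces.linear scale fun_scale \<delta>"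
    and delta_in: "\<delta> x \<in> tensor_space2"
    and linear_alpha: "Vector_Spaces.linear scale scale \<alpha>"
    and alpha_delta: "\<delta> (\<alpha> x) = map_lin_lin \<alpha> \<alpha> (\<delta> x)"
    and delta_antisym: "twist (\<delta> x) = - \<delta> x"
    and hom_coJacobi: "cyclic_sum (map_lin_comult \<alpha> \<delta> (\<delta> x)) = 0"

locale Hom_Lie_bialgebra =
  Hom_Lie_algebra scale br \<alpha> + Hom_Lie_coalgebra scale \<delta> \<alpha>
  for scale :: "'k::field_char_0 \<Rightarrow> 'a::ab_group_add \<Rightarrow> 'a" and br \<delta> \<alpha> +
  assumes delta_br:
    "\<delta> (br (x \<otimes> y)) = adj br \<alpha> (\<alpha> x) (\<delta> y) - adj br \<alpha> (\<alpha> y) (\<delta> x)"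

locale coboundary_Hom_Lie_bialgebra = Hom_Lie_bialgebra scale br \<delta> \<alpha>
  for scale :: "'k::field_char_0 \<Rightarrow> 'a::ab_group_add \<Rightarrow> 'a" and br \<delta> \<alpha> +
  fixes r :: "('a, 'k) tensor2"
  assumes r_in: "r \<in> tensor_space2"
    and r_invariant: "map_lin_lin \<alpha> \<alpha> r = r"
    and delta_eq: "\<delta> = (\<lambda>x. adj br \<alpha> x r)"

end

theory Submission
  imports Defs
begin

text \<open>
  The commutator of a Hom-associative product is a Hom-Lie bracket, and dually the cocommutator
  of a Hom-coassociative coproduct is a Hom-Lie cobracket: by coassociativity all four terms of
  \<open>(\<alpha> \<otimes> \<delta>) \<circ> \<delta>\<close> are permutations of the single tensor \<open>(\<alpha> \<otimes> \<Delta>) (\<Delta> a)\<close>, and they cancel under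
  the cyclic sum.  Anti-symmetry of \<open>r\<close> turns \<open>(Id - \<tau>) [a, r]\<^sub>*\<close> into \<open>ad\<^sub>a(r)\<close>.  Since \<open>r\<close> is
  \<open>\<alpha>\<close>-invariant, the cocycle condition for \<open>ad(r)\<close> is the Hom-Jacobi identity in each tensor
  factor, the mixed terms cancelling.
\<close>

section \<open>Equational rules for linear and multilinear maps\<close>

lemma linear_rules:
  assumes "Vector_Spaces.linear sV sW f"
  shows "f (x + y) = f x + f y" "f (x - y) = f x - f y" "f (- x) = - f x" "f (sV c x) = sW c (f x)"
proof -
  interpret Vector_Spaces.linear sV sW f by fact
  show "f (x + y) = f x + f y" "f (x - y) = f x - f y" "f (- x) = - f x" "f (sV c x) = sW c (f x)"
    by (rule add diff neg scale)+
qed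

lemma fun_scale_distribs:
  fixes c :: "'k::field" and s t :: "'b \<Rightarrow> 'k"
  shows "fun_scale c (s + t) = fun_scale c s + fun_scale c t"
    and "fun_scale c (s - t) = fun_scale c s - fun_scale c t"
  by (auto simp: fun_scale_def fun_eq_iff algebra_simps)

text \<open>
  Tensors are functions here; these rules would rewrite an \<open>\<eta>\<close>-expanded sum of tensors pointwise.
\<close>

declare plus_fun_apply [simp del] minus_apply [simp del] uminus_apply [simp del]

context vector_space
begin

text \<open>Reduces the well-definedness of a lift to equations that rewriting can check.\<close>

lemma bilinear_mapI:
  assumes "vector_space sV"
    and "\<And>x x' y. f (x + x') y = f x y + f x' y" "\<And>x y y'. f x (y + y') = f x y + f x y'"
    and "\<And>c x y. f (scale c x) y = sV c (f x y)" "\<And>c x y. f x (scale c y) = sV c (f x y)"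
  shows "bilinear_map sV f"
  using assms vector_space_axioms unfolding bilinear_map_def linear_iff by simp

lemma trilinear_mapI:
  assumes "vector_space sV"
    and "\<And>x x' y z. f (x + x') y z = f x y z + f x' y z"
      "\<And>x y y' z. f x (y + y') z = f x y z + f x y' z"
      "\<And>x y z z'. f x y (z + z') = f x y z + f x y z'"
    and "\<And>c x y z. f (scale c x) y z = sV c (f x y z)"
      "\<And>c x y z. f x (scale c y) z = sV c (f x y z)"
      "\<And>c x y z. f x y (scale c z) = sV c (f x y z)"
  shows "trilinear_map sV f"
  using assms vector_space_axioms unfolding trilinear_map_def linear_iff by simp

section \<open>Pure tensors and induction on the tensor spaces\<close>

lemma tensor2_rules:
  "(x + x') \<otimes> y = x \<otimes> y + x' \<otimes> y" "y \<otimes> (x + x') = y \<otimes> x + y \<otimes> x'"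
  "(x - x') \<otimes> y = x \<otimes> y - x' \<otimes> y" "y \<otimes> (x - x') = y \<otimes> x - y \<otimes> x'"
  "(- x) \<otimes> y = - (x \<otimes> y)" "y \<otimes> (- x) = - (y \<otimes> x)"
  "scale c x \<otimes> y = fun_scale c (x \<otimes> y)" "y \<otimes> scale c x = fun_scale c (y \<otimes> x)"
  using bilinear_tensor2 linear_rules[of scale fun_scale "\<lambda>x. x \<otimes> y"]
    linear_rules[of scale fun_scale "\<lambda>x. y \<otimes> x"]
  unfolding bilinear_map_def by metis+

lemma tensor3_rules:
  "tensor3 (x + x') y z = tensor3 x y z + tensor3 x' y z"
  "tensor3 y (x + x') z = tensor3 y x z + tensor3 y x' z"
  "tensor3 y z (x + x') = tensor3 y z x + tensor3 y z x'"
  "tensor3 (scale c x) y z = fun_scale c (tensor3 x y z)"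
  "tensor3 y (scale c x) z = fun_scale c (tensor3 y x z)"
  "tensor3 y z (scale c x) = fun_scale c (tensor3 y z x)"
  using trilinear_tensor3 unfolding trilinear_map_def linear_iff by blast+

text \<open>The index type \<open>'f\<close> stays free, so one interpretation serves functionals on
  bilinear and on trilinear forms.\<close>

interpretation F: vector_space "fun_scale :: 'a \<Rightarrow> ('f \<Rightarrow> 'a) \<Rightarrow> 'f \<Rightarrow> 'a"
  by (rule vector_space_fun_scale)

lemma tensor_space2_closed [simp]:
  "x \<otimes> y \<in> tensor_space2"
  "s \<in> tensor_space2 \<Longrightarrow> t \<in> tensor_space2 \<Longrightarrow> s + t \<in> tensor_space2"
  "s \<in> tensor_space2 \<Longrightarrow> t \<in> tensor_space2 \<Longrightarrow> s - t \<in> tensor_space2"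
  "t \<in> tensor_space2 \<Longrightarrow> - t \<in> tensor_space2"
  "t \<in> tensor_space2 \<Longrightarrow> fun_scale c t \<in> tensor_space2"
  unfolding tensor_space2_def
  by (auto intro: F.span_base F.span_add F.span_diff F.span_neg F.span_scale)

lemma tensor_space3_closed [simp]:
  "tensor3 x y z \<in> tensor_space3"
  "s \<in> tensor_space3 \<Longrightarrow> t \<in> tensor_space3 \<Longrightarrow> s + t \<in> tensor_space3"
  unfolding tensor_space3_def by (auto intro: F.span_base F.span_add)

text \<open>There is no case for scalars: a coefficient can be absorbed into the first factor of a
  pure tensor, so every tensor is a sum of pure ones.\<close>

lemma tensor_space2_induct [consumes 1, case_names pure add]:
  assumes t: "t \<in> tensor_space2"
    and pure: "\<And>x y. P (x \<otimes> y)"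
    and add: "\<And>s t. \<lbrakk>s \<in> tensor_space2; t \<in> tensor_space2; P s; P t\<rbrakk> \<Longrightarrow> P (s + t)"
  shows "P t"
proof -
  have "t \<in> tensor_space2 \<and> P t"
    using t[unfolded tensor_space2_def]
  proof (induction rule: F.span_induct_alt)
    case base
    \<comment> \<open>Zero is itself a pure tensor. Spelling the first factor as
      \<open>scale 0 0\<close> lets \<open>tensor2_rules\<close> move the scalar out.\<close>
    have "scale 0 0 \<otimes> 0 = 0" unfolding tensor2_rules by (rule F.scale_zero_left)
    then show ?case using pure[of "scale 0 0" 0] tensor_space2_closed(1)[of "scale 0 0" 0]
      by (simp only: simp_thms)
  next
    case (step c b t)
    then obtain x y where "b = x \<otimes> y" by blast
    then have "fun_scale c b = scale c x \<otimes> y" by (simp only: tensor2_rules)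
    then show ?case using step add pure tensor_space2_closed(1,2) by (simp only: simp_thms)
  qed
  then show ?thesis ..
qed

lemma tensor_space3_induct [consumes 1, case_names pure add]:
  assumes t: "t \<in> tensor_space3"
    and pure: "\<And>x y z. P (tensor3 x y z)"
    and add: "\<And>s t. \<lbrakk>s \<in> tensor_space3; t \<in> tensor_space3; P s; P t\<rbrakk> \<Longrightarrow> P (s + t)"
  shows "P t"
proof -
  have "t \<in> tensor_space3 \<and> P t"
    using t[unfolded tensor_space3_def]
  proof (induction rule: F.span_induct_alt)
    case base
    have "tensor3 (scale 0 0) 0 0 = 0" unfolding tensor3_rules by (rule F.scale_zero_left)
    then show ?case using pure[of "scale 0 0" 0 0] tensor_space3_closed(1)[of "scale 0 0" 0 0]
      by (simp only: simp_thms)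
  next
    case (step c b t)
    then obtain x y z where "b = tensor3 x y z" by blast
    then have "fun_scale c b = tensor3 (scale c x) y z" by (simp only: tensor3_rules)
    then show ?case using step add pure tensor_space3_closed(1,2) by (simp only: simp_thms)
  qed
  then show ?thesis ..
qed

lemmas tensor_rules = tensor2_rules tensor3_rules fun_scale_distribs

lemmas lift2_fun_scale = linear_lift2[OF vector_space_fun_scale]
  lift2_tensor2[OF vector_space_fun_scale]
lemmas lift3_fun_scale = linear_lift3[OF vector_space_fun_scale]
  lift3_tensor3[OF vector_space_fun_scale]

section \<open>Permutations of tensor factors\<close>

lemma linear_twist: "Vector_Spaces.linear fun_scale fun_scale twist"
  and twist_tensor2 [simp]: "twist (x \<otimes> y) = y \<otimes> x"
proof -
  \<comment> \<open>A lift is a chosen map, about which nothing is known until the prescribed values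
    are shown to be multilinear. The same check precedes the rules for every lifted map
    below.\<close>
  have *: "bilinear_map fun_scale (\<lambda>x y. y \<otimes> x)"
    by (rule bilinear_mapI[OF vector_space_fun_scale]) (simp_all add: tensor_rules)
  show "Vector_Spaces.linear fun_scale fun_scale twist" "twist (x \<otimes> y) = y \<otimes> x"
    unfolding twist_def by (rule lift2_fun_scale[OF *])+
qed

lemmas twist_rules [simp] = linear_rules[OF linear_twist]

lemma twist_in [simp]: "t \<in> tensor_space2 \<Longrightarrow> twist t \<in> tensor_space2"
  by (induction rule: tensor_space2_induct) auto

lemma twist_twist [simp]: "t \<in> tensor_space2 \<Longrightarrow> twist (twist t) = t"
  by (induction rule: tensor_space2_induct) auto

lemma linear_cyclic: "Vector_Spaces.linear fun_scale fun_scale cyclic"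
  and cyclic_tensor3 [simp]: "cyclic (tensor3 x y z) = tensor3 z x y"
proof -
  have *: "trilinear_map fun_scale (\<lambda>x y z. tensor3 z x y)"
    by (rule trilinear_mapI[OF vector_space_fun_scale]) (simp_all add: tensor_rules)
  show "Vector_Spaces.linear fun_scale fun_scale cyclic" "cyclic (tensor3 x y z) = tensor3 z x y"
    unfolding cyclic_def by (rule lift3_fun_scale[OF *])+
qed

lemmas cyclic_rules [simp] = linear_rules[OF linear_cyclic]

lemma cyclic_in [simp]: "t \<in> tensor_space3 \<Longrightarrow> cyclic t \<in> tensor_space3"
  by (induction rule: tensor_space3_induct) auto

text \<open>This is the twist in the last two factors. It expresses the inner cocommutator in the
  co-Jacobi sum.\<close>

definition swap23 :: "('b, 'a) tensor3 \<Rightarrow> ('b, 'a) tensor3"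
  where "swap23 = lift3 fun_scale (\<lambda>x y z. tensor3 x z y)"

lemma linear_swap23: "Vector_Spaces.linear fun_scale fun_scale swap23"
  and swap23_tensor3 [simp]: "swap23 (tensor3 x y z) = tensor3 x z y"
proof -
  have *: "trilinear_map fun_scale (\<lambda>x y z. tensor3 x z y)"
    by (rule trilinear_mapI[OF vector_space_fun_scale]) (simp_all add: tensor_rules)
  show "Vector_Spaces.linear fun_scale fun_scale swap23" "swap23 (tensor3 x y z) = tensor3 x z y"
    unfolding swap23_def by (rule lift3_fun_scale[OF *])+
qed

lemmas swap23_rules [simp] = linear_rules[OF linear_swap23]

lemma cyclic_sum_rules:
  "cyclic_sum (s + t) = cyclic_sum s + cyclic_sum t"
  "cyclic_sum (s - t) = cyclic_sum s - cyclic_sum t"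
  by (simp_all add: cyclic_sum_def)

lemma cyclic_sum_cyclic: "t \<in> tensor_space3 \<Longrightarrow> cyclic_sum (cyclic t) = cyclic_sum t"
  by (induction rule: tensor_space3_induct) (simp_all add: cyclic_sum_def add_ac)

text \<open>Conjugation by a transposition inverts a 3-cycle: \<open>swap23\<close> after
  \<open>cyclic\<close> is \<open>cyclic\<close> twice after \<open>swap23\<close>, and the cyclic
  sum absorbs powers of \<open>cyclic\<close>.\<close>

lemma cyclic_sum_swap23_cyclic:
  "t \<in> tensor_space3 \<Longrightarrow> cyclic_sum (swap23 (cyclic t)) = cyclic_sum (swap23 t)"
proof (induction rule: tensor_space3_induct)
  case (pure x y z)
  show ?case by (simp add: cyclic_sum_def add_ac)
qed (simp add: cyclic_sum_rules)

section \<open>Products of a vector with a 2-tensor\<close>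

lemma linear_tensor12: "Vector_Spaces.linear fun_scale fun_scale (tensor12 a)"
  and tensor12_tensor2 [simp]: "tensor12 a (x \<otimes> y) = tensor3 a x y"
proof -
  have *: "bilinear_map fun_scale (\<lambda>x y. tensor3 a x y)"
    by (rule bilinear_mapI[OF vector_space_fun_scale]) (simp_all add: tensor_rules)
  show "Vector_Spaces.linear fun_scale fun_scale (tensor12 a)"
    "tensor12 a (x \<otimes> y) = tensor3 a x y"
    unfolding tensor12_def by (rule lift2_fun_scale[OF *])+
qed

lemmas tensor12_rules [simp] = linear_rules[OF linear_tensor12]

text \<open>Linearity in the vector does not come from the lift, which is linear in the tensor. For
  each vector a separate map is chosen, and these maps are related only on
  \<open>tensor_space2\<close>.\<close>

lemma tensor12_left:
  assumes "t \<in> tensor_space2"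
  shows "tensor12 (a + b) t = tensor12 a t + tensor12 b t"
    and "tensor12 (scale c a) t = fun_scale c (tensor12 a t)"
  using assms by (induction rule: tensor_space2_induct) (simp_all add: tensor_rules)

lemma tensor12_in [simp]: "t \<in> tensor_space2 \<Longrightarrow> tensor12 a t \<in> tensor_space3"
  by (induction rule: tensor_space2_induct) auto

lemma linear_tensor21: "Vector_Spaces.linear fun_scale fun_scale (\<lambda>t. tensor21 t a)"
  and tensor21_tensor2 [simp]: "tensor21 (x \<otimes> y) a = tensor3 x y a"
proof -
  have *: "bilinear_map fun_scale (\<lambda>x y. tensor3 x y a)"
    by (rule bilinear_mapI[OF vector_space_fun_scale]) (simp_all add: tensor_rules)
  show "Vector_Spaces.linear fun_scale fun_scale (\<lambda>t. tensor21 t a)"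
    "tensor21 (x \<otimes> y) a = tensor3 x y a"
    unfolding tensor21_def by (rule lift2_fun_scale[OF *])+
qed

lemmas tensor21_rules [simp] = linear_rules[OF linear_tensor21]

lemma tensor21_right:
  assumes "t \<in> tensor_space2"
  shows "tensor21 t (a + b) = tensor21 t a + tensor21 t b"
    and "tensor21 t (scale c a) = fun_scale c (tensor21 t a)"
  using assms by (induction rule: tensor_space2_induct) (simp_all add: tensor_rules)

lemma swap23_tensor12: "t \<in> tensor_space2 \<Longrightarrow> swap23 (tensor12 a t) = tensor12 a (twist t)"
  by (induction rule: tensor_space2_induct) auto

lemma cyclic_tensor21: "t \<in> tensor_space2 \<Longrightarrow> cyclic (tensor21 t a) = tensor12 a t"
  by (induction rule: tensor_space2_induct) auto

section \<open>Tensor products of maps, the star bracket and the adjoint action\<close>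

lemma
  assumes f: "Vector_Spaces.linear scale scale f" and g: "Vector_Spaces.linear scale scale g"
  shows linear_map_lin_lin: "Vector_Spaces.linear fun_scale fun_scale (map_lin_lin f g)"
    and map_lin_lin_tensor2: "map_lin_lin f g (x \<otimes> y) = f x \<otimes> g y"
proof -
  have *: "bilinear_map fun_scale (\<lambda>x y. f x \<otimes> g y)"
    by (rule bilinear_mapI[OF vector_space_fun_scale])
      (simp_all add: tensor_rules linear_rules[OF f] linear_rules[OF g])
  show "Vector_Spaces.linear fun_scale fun_scale (map_lin_lin f g)"
    "map_lin_lin f g (x \<otimes> y) = f x \<otimes> g y"
    unfolding map_lin_lin_def by (rule lift2_fun_scale[OF *])+
qed

lemma linear_on_tensor_space2_rules:
  assumes "linear_on tensor_space2 fun_scale sV m"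
  shows "s \<in> tensor_space2 \<Longrightarrow> t \<in> tensor_space2 \<Longrightarrow> m (s + t) = m s + m t"
    and "s \<in> tensor_space2 \<Longrightarrow> t \<in> tensor_space2 \<Longrightarrow>
      m (s - t) = m s - (m t :: 'v::ab_group_add)"
    and "t \<in> tensor_space2 \<Longrightarrow> m (- t) = - m t"
    and "t \<in> tensor_space2 \<Longrightarrow> m (fun_scale c t) = sV c (m t)"
proof -
  show add: "m (s + t) = m s + m t" if "s \<in> tensor_space2" "t \<in> tensor_space2" for s t
    using that assms unfolding linear_on_def by blast
  show diff: "m (s - t) = m s - m t" if "s \<in> tensor_space2" "t \<in> tensor_space2" for s t
    using add[of "s - t" t] that by simp
  show "m (- t) = - m t" if "t \<in> tensor_space2" for t
    \<comment> \<open>Here \<open>- t\<close> is treated as \<open>(t - t) - t\<close>, so that only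
      differences inside \<open>tensor_space2\<close> occur.\<close>
    using diff[OF tensor_space2_closed(3)[OF that that] that] diff[OF that that] by simp
  show "t \<in> tensor_space2 \<Longrightarrow> m (fun_scale c t) = sV c (m t)"
    using assms unfolding linear_on_def by blast
qed

lemma
  assumes f: "Vector_Spaces.linear scale scale f"
    and m: "linear_on tensor_space2 fun_scale scale m"
  shows linear_map_lin_mult: "Vector_Spaces.linear fun_scale fun_scale (map_lin_mult f m)"
    and map_lin_mult_tensor3: "map_lin_mult f m (tensor3 x y z) = f x \<otimes> m (y \<otimes> z)"
    and linear_map_mult_lin: "Vector_Spaces.linear fun_scale fun_scale (map_mult_lin m f)"
    and map_mult_lin_tensor3: "map_mult_lin m f (tensor3 x y z) = m (x \<otimes> y) \<otimes> f z"
proof -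
  have *: "trilinear_map fun_scale (\<lambda>x y z. f x \<otimes> m (y \<otimes> z))"
    by (rule trilinear_mapI[OF vector_space_fun_scale])
      (simp_all add: tensor_rules linear_rules[OF f] linear_on_tensor_space2_rules[OF m])
  show "Vector_Spaces.linear fun_scale fun_scale (map_lin_mult f m)"
    "map_lin_mult f m (tensor3 x y z) = f x \<otimes> m (y \<otimes> z)"
    unfolding map_lin_mult_def by (rule lift3_fun_scale[OF *])+
  have *: "trilinear_map fun_scale (\<lambda>x y z. m (x \<otimes> y) \<otimes> f z)"
    by (rule trilinear_mapI[OF vector_space_fun_scale])
      (simp_all add: tensor_rules linear_rules[OF f] linear_on_tensor_space2_rules[OF m])
  show "Vector_Spaces.linear fun_scale fun_scale (map_mult_lin m f)"
    "map_mult_lin m f (tensor3 x y z) = m (x \<otimes> y) \<otimes> f z"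
    unfolding map_mult_lin_def by (rule lift3_fun_scale[OF *])+
qed

lemma map_mult_lin_in:
  assumes f: "Vector_Spaces.linear scale scale f"
    and m: "linear_on tensor_space2 fun_scale scale m" and t: "t \<in> tensor_space3"
  shows "map_mult_lin m f t \<in> tensor_space2"
  using t by (induction rule: tensor_space3_induct)
    (simp_all add: map_mult_lin_tensor3[OF f m] linear_rules[OF linear_map_mult_lin[OF f m]])

lemma
  assumes f: "Vector_Spaces.linear scale scale f"
    and d: "Vector_Spaces.linear scale fun_scale d" "\<And>x. d x \<in> tensor_space2"
  shows linear_map_lin_comult: "Vector_Spaces.linear fun_scale fun_scale (map_lin_comult f d)"
    and map_lin_comult_tensor2: "map_lin_comult f d (x \<otimes> y) = tensor12 (f x) (d y)"
    and linear_map_comult_lin: "Vector_Spaces.linear fun_scale fun_scale (map_comult_lin d f)"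
    and map_comult_lin_tensor2: "map_comult_lin d f (x \<otimes> y) = tensor21 (d x) (f y)"
proof -
  have *: "bilinear_map fun_scale (\<lambda>x y. tensor12 (f x) (d y))"
    by (rule bilinear_mapI[OF vector_space_fun_scale])
      (simp_all add: d(2) tensor12_left linear_rules[OF f] linear_rules[OF d(1)])
  show "Vector_Spaces.linear fun_scale fun_scale (map_lin_comult f d)"
    "map_lin_comult f d (x \<otimes> y) = tensor12 (f x) (d y)"
    unfolding map_lin_comult_def by (rule lift2_fun_scale[OF *])+
  have *: "bilinear_map fun_scale (\<lambda>x y. tensor21 (d x) (f y))"
    by (rule bilinear_mapI[OF vector_space_fun_scale])
      (simp_all add: d(2) tensor21_right linear_rules[OF f] linear_rules[OF d(1)])
  show "Vector_Spaces.linear fun_scale fun_scale (map_comult_lin d f)"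
    "map_comult_lin d f (x \<otimes> y) = tensor21 (d x) (f y)"
    unfolding map_comult_lin_def by (rule lift2_fun_scale[OF *])+
qed

lemma
  assumes f: "Vector_Spaces.linear scale scale f"
    and m: "linear_on tensor_space2 fun_scale scale m"
  shows linear_star_bracket: "Vector_Spaces.linear fun_scale fun_scale (star_bracket m f a)"
    and star_bracket_tensor2:
      "star_bracket m f a (u \<otimes> v) = m (a \<otimes> u) \<otimes> f v - f u \<otimes> m (v \<otimes> a)"
    and linear_adj: "Vector_Spaces.linear fun_scale fun_scale (adj m f a)"
    and adj_tensor2: "adj m f a (u \<otimes> v) = m (a \<otimes> u) \<otimes> f v + f u \<otimes> m (a \<otimes> v)"
proof -
  have *: "bilinear_map fun_scale (\<lambda>u v. m (a \<otimes> u) \<otimes> f v - f u \<otimes> m (v \<otimes> a))"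
    by (rule bilinear_mapI[OF vector_space_fun_scale])
      (simp_all add: tensor_rules linear_rules[OF f] linear_on_tensor_space2_rules[OF m])
  show "Vector_Spaces.linear fun_scale fun_scale (star_bracket m f a)"
    "star_bracket m f a (u \<otimes> v) = m (a \<otimes> u) \<otimes> f v - f u \<otimes> m (v \<otimes> a)"
    unfolding star_bracket_def by (rule lift2_fun_scale[OF *])+
  have *: "bilinear_map fun_scale (\<lambda>u v. m (a \<otimes> u) \<otimes> f v + f u \<otimes> m (a \<otimes> v))"
    by (rule bilinear_mapI[OF vector_space_fun_scale])
      (simp_all add: tensor_rules linear_rules[OF f] linear_on_tensor_space2_rules[OF m])
  show "Vector_Spaces.linear fun_scale fun_scale (adj m f a)"
    "adj m f a (u \<otimes> v) = m (a \<otimes> u) \<otimes> f v + f u \<otimes> m (a \<otimes> v)"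
    unfolding adj_def by (rule lift2_fun_scale[OF *])+
qed

text \<open>The twist inside \<open>e\<close> acts on the last two of three factors, where it
  becomes \<open>swap23\<close>.\<close>

lemma map_lin_comult_cocommutator:
  assumes f: "Vector_Spaces.linear scale scale f"
    and d: "Vector_Spaces.linear scale fun_scale d" "\<And>x. d x \<in> tensor_space2"
    and e: "Vector_Spaces.linear scale fun_scale e" "\<And>x. e x = d x - twist (d x)"
    and t: "t \<in> tensor_space2"
  shows "map_lin_comult f e t = map_lin_comult f d t - swap23 (map_lin_comult f d t)"
proof -
  have ein: "e x \<in> tensor_space2" for x by (simp add: d(2) e(2))
  have tensor12_e: "tensor12 a (e y) = tensor12 a (d y) - swap23 (tensor12 a (d y))" for a y
    by (simp add: d(2) e(2) swap23_tensor12)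
  show ?thesis
    using t by (induction rule: tensor_space2_induct)
      (simp_all add: map_lin_comult_tensor2[OF f d] map_lin_comult_tensor2[OF f e(1) ein]
        linear_rules[OF linear_map_lin_comult[OF f d]]
        linear_rules[OF linear_map_lin_comult[OF f e(1) ein]] tensor12_e)
qed

text \<open>On \<open>x \<otimes> y\<close> both sides are the product of \<open>f y\<close> with
  \<open>d x\<close>: the cyclic permutation brings the last factor to the front. Coassociativity
  then makes the twist a permutation of one fixed tensor.\<close>

lemma map_lin_comult_twist:
  assumes f: "Vector_Spaces.linear scale scale f"
    and d: "Vector_Spaces.linear scale fun_scale d" "\<And>x. d x \<in> tensor_space2"
    and t: "t \<in> tensor_space2"
  shows "map_lin_comult f d (twist t) = cyclic (map_comult_lin d f t)"
  using t by (induction rule: tensor_space2_induct)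
    (simp_all add: map_lin_comult_tensor2[OF f d] map_comult_lin_tensor2[OF f d]
      linear_rules[OF linear_map_lin_comult[OF f d]]
      linear_rules[OF linear_map_comult_lin[OF f d]] cyclic_tensor21 d(2))

lemma map_lin_comult_in:
  assumes f: "Vector_Spaces.linear scale scale f"
    and d: "Vector_Spaces.linear scale fun_scale d" "\<And>x. d x \<in> tensor_space2"
    and t: "t \<in> tensor_space2"
  shows "map_lin_comult f d t \<in> tensor_space3"
  using t by (induction rule: tensor_space2_induct)
    (simp_all add: map_lin_comult_tensor2[OF f d]
      linear_rules[OF linear_map_lin_comult[OF f d]] d(2))

end

section \<open>The adjoint action of a Hom-Lie algebra on 2-tensors\<close>

context Hom_Lie_algebra
begin

lemmas br_rules = linear_on_tensor_space2_rules[OF linear_br]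

lemma alpha_br_tensor2: "\<alpha> (br (x \<otimes> y)) = br (\<alpha> x \<otimes> \<alpha> y)"
  using alpha_br[of "x \<otimes> y"] by (simp add: map_lin_lin_tensor2[OF linear_alpha linear_alpha])

text \<open>The Hom-Jacobi identity in the form of a rewrite rule for the action of a bracket,
  obtained from the cyclic form by anti-symmetry.\<close>

lemma hom_Jacobi_ad:
  "br (br (x \<otimes> y) \<otimes> \<alpha> z) = br (\<alpha> x \<otimes> br (y \<otimes> z)) - br (\<alpha> y \<otimes> br (x \<otimes> z))"
proof -
  have "br (br (x \<otimes> y) \<otimes> \<alpha> z) + br (br (z \<otimes> x) \<otimes> \<alpha> y) + br (br (y \<otimes> z) \<otimes> \<alpha> x) = 0"
    using hom_Jacobi[of "tensor3 x y z"]
    by (simp add: cyclic_sum_def br_rules map_mult_lin_tensor3[OF linear_alpha linear_br]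
        linear_rules[OF linear_map_mult_lin[OF linear_alpha linear_br]])
  moreover have "br (br (z \<otimes> x) \<otimes> \<alpha> y) = br (\<alpha> y \<otimes> br (x \<otimes> z))"
  proof -
    \<comment> \<open>Both the outer and the inner bracket are reversed, so the two signs
      cancel.\<close>
    have "br (br (z \<otimes> x) \<otimes> \<alpha> y) = - br (\<alpha> y \<otimes> br (z \<otimes> x))" by (rule br_antisym)
    also have "\<dots> = br (\<alpha> y \<otimes> br (x \<otimes> z))"
      by (subst br_antisym[of z x]) (simp add: tensor2_rules br_rules)
    finally show ?thesis .
  qed
  moreover have "br (br (y \<otimes> z) \<otimes> \<alpha> x) = - br (\<alpha> x \<otimes> br (y \<otimes> z))" by (rule br_antisym)
  ultimately show ?thesis by (simp add: algebra_simps)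
qed

text \<open>Two adjoint actions apply \<alpha> twice to a passive factor, and
  \<open>hom_Jacobi_ad\<close> needs \<alpha> on the active one; hence \<alpha> is applied to both
  factors of \<open>t\<close> on the left. The mixed terms form an expression symmetric in
  \<open>x\<close> and \<open>y\<close>, since \<alpha> commutes with the bracket.\<close>

lemma adj_br:
  assumes "t \<in> tensor_space2"
  shows "adj br \<alpha> (br (x \<otimes> y)) (map_lin_lin \<alpha> \<alpha> t) =
    adj br \<alpha> (\<alpha> x) (adj br \<alpha> y t) - adj br \<alpha> (\<alpha> y) (adj br \<alpha> x t)"
  using assms by (induction rule: tensor_space2_induct)
    (simp_all add: adj_tensor2[OF linear_alpha linear_br]
      linear_rules[OF linear_adj[OF linear_alpha linear_br]]
      map_lin_lin_tensor2[OF linear_alpha linear_alpha]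
      linear_rules[OF linear_map_lin_lin[OF linear_alpha linear_alpha]]
      hom_Jacobi_ad tensor2_rules alpha_br_tensor2)

end

section \<open>The commutator bracket and the cocommutator\<close>

context eps_Hom_bialgebra
begin

text \<open>The pointwise form suits rewriting; \<open>commutator_eq_comp\<close> recovers the
  composite of maps.\<close>

definition commutator :: "('a, 'k) tensor2 \<Rightarrow> 'a"
  where "commutator t = \<mu> (t - twist t)"

definition cocommutator :: "'a \<Rightarrow> ('a, 'k) tensor2"
  where "cocommutator a = \<Delta> a - twist (\<Delta> a)"

lemma commutator_eq_comp: "commutator = \<mu> \<circ> (id - twist)"
  by (simp add: fun_eq_iff commutator_def minus_apply)

lemma cocommutator_eq_comp: "cocommutator = (id - twist) \<circ> \<Delta>"
  \<comment> \<open>Tensors are functions too, so the rule is pinned to the difference of maps, and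
    \<open>ext\<close> is applied only once.\<close>
  by (rule ext) (simp add: cocommutator_def minus_apply[where A = id])

lemmas mu_rules = linear_on_tensor_space2_rules[OF linear_mu]
lemmas alpha_rules = linear_rules[OF linear_alpha]
lemmas alpha2_rules = map_lin_lin_tensor2[OF linear_alpha linear_alpha]
  linear_rules[OF linear_map_lin_lin[OF linear_alpha linear_alpha]]

text \<open>As a rewrite rule this brackets all triple products to the left, giving a normal
  form.\<close>

lemma mu_hom_assoc: "\<mu> (\<alpha> x \<otimes> \<mu> (y \<otimes> z)) = \<mu> (\<mu> (x \<otimes> y) \<otimes> \<alpha> z)"
  using hom_assoc[of "tensor3 x y z"]
  by (simp add: map_lin_mult_tensor3[OF linear_alpha linear_mu]
      map_mult_lin_tensor3[OF linear_alpha linear_mu])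

lemma alpha2_twist:
  "t \<in> tensor_space2 \<Longrightarrow> map_lin_lin \<alpha> \<alpha> (twist t) = twist (map_lin_lin \<alpha> \<alpha> t)"
  by (induction rule: tensor_space2_induct) (simp_all add: alpha2_rules)

lemma alpha2_in: "t \<in> tensor_space2 \<Longrightarrow> map_lin_lin \<alpha> \<alpha> t \<in> tensor_space2"
  by (induction rule: tensor_space2_induct) (simp_all add: alpha2_rules)

lemma linear_commutator: "linear_on tensor_space2 fun_scale scale commutator"
  unfolding linear_on_def commutator_def
  by (simp add: fun_scale_distribs mu_rules scale_right_diff_distrib algebra_simps)

lemma commutator_tensor2: "commutator (x \<otimes> y) = \<mu> (x \<otimes> y) - \<mu> (y \<otimes> x)"
  by (simp add: commutator_def mu_rules)

lemma Hom_Lie_algebra_commutator: "Hom_Lie_algebra scale commutator \<alpha>"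
proof (intro Hom_Lie_algebra.intro Hom_Lie_algebra_axioms.intro vector_space_axioms)
  show "linear_on tensor_space2 fun_scale scale commutator" by (rule linear_commutator)
  show "Vector_Spaces.linear scale scale \<alpha>" by (rule linear_alpha)
  show "commutator (x \<otimes> y) = - commutator (y \<otimes> x)" for x y
    by (simp add: commutator_tensor2)
  show "\<alpha> (commutator t) = commutator (map_lin_lin \<alpha> \<alpha> t)" if "t \<in> tensor_space2" for t
    using that by (simp add: commutator_def mu_rules alpha_rules alpha_mu alpha2_twist alpha2_in)
  note m = linear_rules[OF linear_map_mult_lin[OF linear_alpha linear_commutator]]
    map_mult_lin_tensor3[OF linear_alpha linear_commutator]
  note c = linear_on_tensor_space2_rules[OF linear_commutator]
  show "commutator (map_mult_lin commutator \<alpha> (cyclic_sum u)) = 0" if "u \<in> tensor_space3" for u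
    using that
  proof (induction rule: tensor_space3_induct)
    case (pure x y z)
    show ?case
      \<comment> \<open>The three double commutators expand to twelve products. Once bracketed to
        the left, each of the six orderings of \<open>x\<close>, \<open>y\<close>, \<open>z\<close>
        occurs twice, with opposite signs.\<close>
      by (simp add: cyclic_sum_def m c commutator_tensor2 tensor2_rules mu_rules mu_hom_assoc)
  next
    case (add s t)
    \<comment> \<open>The commutator is known to be additive only on \<open>tensor_space2\<close>,
      so its arguments must be shown to lie there.\<close>
    have "map_mult_lin commutator \<alpha> (cyclic_sum u) \<in> tensor_space2" if "u \<in> tensor_space3" for u
    proof -
      have "cyclic_sum u \<in> tensor_space3"
        using that by (simp add: cyclic_sum_def)
      then show ?thesis by (rule map_mult_lin_in[OF linear_alpha linear_commutator])
    qed
    with add show ?case by (simp add: cyclic_sum_rules m c)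
  qed
qed

lemma linear_cocommutator: "Vector_Spaces.linear scale fun_scale cocommutator"
  unfolding linear_iff using vector_space_axioms vector_space_fun_scale
  by (simp add: cocommutator_def linear_rules[OF linear_Delta] fun_scale_distribs)

lemma Hom_Lie_coalgebra_cocommutator: "Hom_Lie_coalgebra scale cocommutator \<alpha>"
proof (intro Hom_Lie_coalgebra.intro Hom_Lie_coalgebra_axioms.intro vector_space_axioms)
  show "Vector_Spaces.linear scale fun_scale cocommutator" by (rule linear_cocommutator)
  show "cocommutator x \<in> tensor_space2" for x by (simp add: cocommutator_def Delta_in)
  show "Vector_Spaces.linear scale scale \<alpha>" by (rule linear_alpha)
  show "cocommutator (\<alpha> x) = map_lin_lin \<alpha> \<alpha> (cocommutator x)" for x
    by (simp add: cocommutator_def alpha2_rules alpha2_twist Delta_in alpha_Delta)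
  show "twist (cocommutator x) = - cocommutator x" for x
    by (simp add: cocommutator_def Delta_in)
  show "cyclic_sum (map_lin_comult \<alpha> cocommutator (cocommutator x)) = 0" for x
  proof -
    note d = linear_alpha linear_Delta Delta_in
    define T where "T = map_lin_comult \<alpha> \<Delta> (\<Delta> x)"
    have T: "T \<in> tensor_space3" unfolding T_def by (rule map_lin_comult_in[OF d Delta_in])
    \<comment> \<open>The twisted summand gives \<open>cyclic\<close> of
      \<open>map_comult_lin \<Delta> \<alpha> (\<Delta> x)\<close>, which is \<open>cyclic T\<close>
      by coassociativity.\<close>
    have "map_lin_comult \<alpha> \<Delta> (cocommutator x) = T - cyclic T"
      by (simp add: cocommutator_def linear_rules[OF linear_map_lin_comult[OF d]]
          map_lin_comult_twist[OF d] Delta_in T_def hom_coassoc)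
    moreover have "cocommutator x \<in> tensor_space2" by (simp add: cocommutator_def Delta_in)
    ultimately have "map_lin_comult \<alpha> cocommutator (cocommutator x) =
        (T - cyclic T) - swap23 (T - cyclic T)"
      by (simp only: map_lin_comult_cocommutator[OF d linear_cocommutator cocommutator_def])
    \<comment> \<open>The cyclic sum already kills \<open>T - cyclic T\<close> and its image under
      \<open>swap23\<close> separately.\<close>
    then show ?thesis
      by (simp add: cyclic_sum_rules cyclic_sum_cyclic[OF T] cyclic_sum_swap23_cyclic[OF T])
  qed
qed

text \<open>On \<open>u \<otimes> v\<close> the first star bracket multiplies \<open>u\<close> by
  \<open>a\<close> from the left and \<open>v\<close> from the right; the twisted one supplies the
  two opposite products. For anti-symmetric \<open>t\<close> the sum becomes the star bracket minus
  its twist.\<close>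

lemma adj_commutator:
  assumes "t \<in> tensor_space2"
  shows "adj commutator \<alpha> a t = star_bracket \<mu> \<alpha> a t + twist (star_bracket \<mu> \<alpha> a (twist t))"
  using assms by (induction rule: tensor_space2_induct)
    (simp_all add: adj_tensor2[OF linear_alpha linear_commutator]
      linear_rules[OF linear_adj[OF linear_alpha linear_commutator]]
      star_bracket_tensor2[OF linear_alpha linear_mu]
      linear_rules[OF linear_star_bracket[OF linear_alpha linear_mu]]
      commutator_tensor2 tensor2_rules)

end

theorem theorem6p12:
  fixes scale :: "'k::field_char_0 \<Rightarrow> 'a::ab_group_add \<Rightarrow> 'a"
    and \<mu> :: "('a, 'k) tensor2 \<Rightarrow> 'a"
    and \<Delta> :: "'a \<Rightarrow> ('a, 'k) tensor2"
    and \<alpha> :: "'a \<Rightarrow> 'a"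
    and r :: "('a, 'k) tensor2"
  assumes "coboundary_eps_Hom_bialgebra scale \<mu> \<Delta> \<alpha> r"
    and "vector_space.twist scale r = - r"
  shows "coboundary_Hom_Lie_bialgebra scale
    (\<mu> \<circ> (id - vector_space.twist scale))
    ((id - vector_space.twist scale) \<circ> \<Delta>) \<alpha> r"
proof -
  interpret coboundary_eps_Hom_bialgebra scale \<mu> \<Delta> \<alpha> r by fact
  interpret L: Hom_Lie_algebra scale commutator \<alpha> by (rule Hom_Lie_algebra_commutator)
  interpret C: Hom_Lie_coalgebra scale cocommutator \<alpha> by (rule Hom_Lie_coalgebra_cocommutator)
  \<comment> \<open>Anti-symmetry replaces \<open>twist r\<close> by \<open>- r\<close> in
    \<open>adj_commutator\<close>, and the star bracket with \<open>r\<close> is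
    \<open>\<Delta> x\<close>.\<close>
  have cocommutator_eq: "cocommutator x = adj commutator \<alpha> x r" for x
    using assms(2) Delta_eq[THEN fun_cong, of x]
    by (simp add: adj_commutator[OF r_in] cocommutator_def
        linear_rules[OF linear_star_bracket[OF linear_alpha linear_mu]])
  show ?thesis
    unfolding commutator_eq_comp[symmetric] cocommutator_eq_comp[symmetric]
  proof (intro coboundary_Hom_Lie_bialgebra.intro coboundary_Hom_Lie_bialgebra_axioms.intro
      Hom_Lie_bialgebra.intro Hom_Lie_bialgebra_axioms.intro
      L.Hom_Lie_algebra_axioms C.Hom_Lie_coalgebra_axioms)
    show "r \<in> tensor_space2" by (rule r_in)
    show "map_lin_lin \<alpha> \<alpha> r = r" by (rule r_invariant)
    show "cocommutator = (\<lambda>x. adj commutator \<alpha> x r)" by (rule ext) (rule cocommutator_eq)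
    show "cocommutator (commutator (x \<otimes> y)) =
        adj commutator \<alpha> (\<alpha> x) (cocommutator y) - adj commutator \<alpha> (\<alpha> y) (cocommutator x)" for x y
      \<comment> \<open>Invariance of \<open>r\<close> removes \<alpha> from the tensor on the left
        of \<open>adj_br\<close>; every \<open>adj\<close> applied to \<open>r\<close> is then a
        cocommutator.\<close>
      using L.adj_br[OF r_in, of x y] by (simp only: cocommutator_eq r_invariant)
  qed
qed

end
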